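(* Let $V:\mathcal S_0^n\to\mathbb R$ be a rotationally invariant radial continuous valuation on the $n$-dimensional star bodies $\mathcal S_0^n$. Then there exists a continuous function $\theta:[0,\infty)\to\mathbb R$ such that, for every $K\in\mathcal S_0^n$, $$V(K)=\int_{S^{n-1}}\theta(\rho_K(t))\,dm(t),$$ where $\rho_K$ is the radial function of $K$ and $m$ is the Lebesgue measure on $S^{n-1}$ normalized so that $m(S^{n-1})=1$. Conversely, let $\theta:[0,\infty)\to\mathbb R$ be a continuous function. Then the map $V:\mathcal S_0^n\to\mathbb R$ given by $$V(K)=\int_{S^{n-1}}\theta(\rho_K(t))\,dm(t)$$ is a radial continuous rotationally invariant valuation.
   Context: $S^{n-1}$ is the Euclidean unit sphere of $\mathbb R^n$. A set $L\subset\mathbb R^n$ is a star set if it contains the origin and every line through $0$ that meets $L$ does so in a (possibly degenerate) line segment. Its radial function is $\rho_L(t)=\sup\{c\ge 0: ct\in L\}$, $t\in S^{n-1}$. $L$ is a star body if $\rho_L$ is continuous on $S^{n-1}$; $\mathcal S_0^n$ is the set of star bodies of $\mathbb R^n$, which are identified with their radial functions (the nonnegative continuous functions on $S^{n-1}$). "Radial continuous" means continuous for the radial metric $\delta(K,L)=\|\rho_K-\rho_L\|_\infty$. $V$ is a valuation if $V(K\cup L)+V(K\cap L)=V(K)+V(L)$ for all $K,L\in\mathcal S_0^n$. $V$ is rotationally invariant if $V(\Phi(L))=V(L)$ for every $L\in\mathcal S_0^n$ and every rotation $\Phi$ of $\mathbb R^n$.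
   Formalization: The existence of θ is stated for n ≥ 2 only; for n = 1 the only rotation is the identity and V(K) = ρ_K(1) is a counterexample. The converse is stated for all n ≥ 1. *)

theory Defs
  imports "HOL-Analysis.Analysis"
begin

text \<open>Since \<open>0 \<in> L\<close>, every line through the origin meets \<open>L\<close>. Line segments are closed,
  so a star set is determined by its radial function.\<close>

definition star_set :: "(real ^ 'n) set \<Rightarrow> bool" where
  "star_set L \<longleftrightarrow> 0 \<in> L \<and> (\<forall>u. u \<noteq> 0 \<longrightarrow> (\<exists>a b. L \<inter> span {u} = closed_segment a b))"

text \<open>Only meaningful for unit vectors \<open>t\<close> and star sets \<open>L\<close>, where the supremum is over a
  nonempty bounded set.\<close>

definition radial_function :: "(real ^ 'n) set \<Rightarrow> real ^ 'n \<Rightarrow> real" where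
  "radial_function L t = Sup {c. 0 \<le> c \<and> c *\<^sub>R t \<in> L}"

definition star_body :: "(real ^ 'n) set \<Rightarrow> bool" where
  "star_body L \<longleftrightarrow> star_set L \<and> continuous_on (sphere 0 1) (radial_function L)"

definition radial_dist :: "(real ^ 'n) set \<Rightarrow> (real ^ 'n) set \<Rightarrow> real" where
  "radial_dist K L = (SUP t\<in>sphere 0 1. \<bar>radial_function K t - radial_function L t\<bar>)"

text \<open>A functional on star bodies is a function on all sets; its values outside the star bodies
  are never used.\<close>

definition radial_continuous :: "((real ^ 'n) set \<Rightarrow> real) \<Rightarrow> bool" where
  "radial_continuous V \<longleftrightarrow>
    (\<forall>K. star_body K \<longrightarrow> (\<forall>\<epsilon>>0. \<exists>\<delta>>0. \<forall>L. star_body L \<longrightarrow> radial_dist K L < \<delta> \<longrightarrow> \<bar>V L - V K\<bar> < \<epsilon>))"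

definition valuation :: "((real ^ 'n) set \<Rightarrow> real) \<Rightarrow> bool" where
  "valuation V \<longleftrightarrow>
    (\<forall>K L. star_body K \<longrightarrow> star_body L \<longrightarrow> V (K \<union> L) + V (K \<inter> L) = V K + V L)"

definition rotation_invariant :: "((real ^ 'n) set \<Rightarrow> real) \<Rightarrow> bool" where
  "rotation_invariant V \<longleftrightarrow>
    (\<forall>L A. star_body L \<longrightarrow> rotation_matrix A \<longrightarrow> V ((\<lambda>x. A *v x) ` L) = V L)"

text \<open>The normalized Lebesgue measure on the unit sphere, defined by polar coordinates: the measure
  of a Borel set \<open>A\<close> of unit vectors is the fraction of the volume of the unit ball taken up by
  the cone \<open>{r *\<^sub>R t | r t. 0 < r \<le> 1 \<and> t \<in> A}\<close>. Recall that \<open>sgn x = x /\<^sub>R norm x\<close>.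
  The restriction only drops a null set, as \<open>sgn\<close> maps all but the origin into the sphere.\<close>

definition sphere_measure :: "(real ^ 'n) measure" where
  "sphere_measure =
    restrict_space (distr (uniform_measure lborel (cball 0 1)) borel sgn) (sphere 0 1)"

lemma space_sphere_measure: "space sphere_measure = sphere 0 1"
  by (simp add: sphere_measure_def space_restrict_space)

lemma sets_sphere_measure: "sets sphere_measure = sets (restrict_space borel (sphere 0 1))"
  by (simp add: sphere_measure_def sets_restrict_space)

lemma emeasure_sphere_measure:
  fixes A :: "(real ^ 'n) set"
  assumes A: "A \<in> sets borel" "A \<subseteq> sphere 0 1"
  shows "emeasure sphere_measure A =
    emeasure lborel {r *\<^sub>R t | r t. 0 < r \<and> r \<le> 1 \<and> t \<in> A} / emeasure lborel (cball 0 1 :: (real ^ 'n) set)"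
proof -
  have "cball 0 1 \<inter> sgn -` A = {r *\<^sub>R t | r t. 0 < r \<and> r \<le> 1 \<and> t \<in> A}" (is "?L = ?R")
  proof (intro equalityI subsetI)
    fix x assume x: "x \<in> ?L"
    then have "sgn x \<in> A" by simp
    moreover from this have "x \<noteq> 0" using A(2) by auto
    moreover from this have "x = norm x *\<^sub>R sgn x" by (simp add: sgn_div_norm)
    ultimately show "x \<in> ?R" using x by (auto intro!: exI[of _ "norm x"] exI[of _ "sgn x"])
  next
    fix x assume "x \<in> ?R"
    then obtain r t where x: "x = r *\<^sub>R t" "0 < r" "r \<le> 1" "t \<in> A" by auto
    then have "norm t = 1" using A(2) by auto
    then have "sgn x = t" "norm x = r" using x by (auto simp: sgn_div_norm)
    then show "x \<in> ?L" using x by simp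
  qed
  moreover have "emeasure sphere_measure A = emeasure lborel (cball 0 1 \<inter> sgn -` A) / emeasure lborel (cball 0 1 :: (real ^ 'n) set)"
    using A by (simp add: sphere_measure_def emeasure_restrict_space emeasure_distr
      emeasure_uniform_measure measurable_sets_borel[OF borel_measurable_sgn])
  ultimately show ?thesis by simp
qed

lemma emeasure_sphere_measure_sphere: "emeasure sphere_measure (sphere 0 1 :: (real ^ 'n) set) = 1"
proof -
  have eq: "{r *\<^sub>R t | r t. 0 < r \<and> r \<le> 1 \<and> t \<in> sphere 0 1} = cball 0 1 - {0 :: real ^ 'n}"
  proof (intro equalityI subsetI)
    fix x :: "real ^ 'n" assume "x \<in> cball 0 1 - {0}"
    then show "x \<in> {r *\<^sub>R t | r t. 0 < r \<and> r \<le> 1 \<and> t \<in> sphere 0 1}"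
      by (auto intro!: exI[of _ "norm x"] exI[of _ "sgn x"] simp: norm_sgn sgn_div_norm)
  qed auto
  have "emeasure lborel (cball 0 1 - {0 :: real ^ 'n}) = emeasure lborel (cball 0 1 :: (real ^ 'n) set)"
    by (subst emeasure_Diff) auto
  moreover have "emeasure lborel (cball 0 1 :: (real ^ 'n) set) \<noteq> 0"
    using content_cball_pos[of 1 "0 :: real ^ 'n"] by (auto simp: measure_def)
  moreover have "emeasure lborel (cball 0 1 :: (real ^ 'n) set) \<noteq> \<infinity>"
    using emeasure_lborel_cball_finite[of "0 :: real ^ 'n" 1] by auto
  ultimately show ?thesis
    by (subst emeasure_sphere_measure) (simp_all only: eq, simp_all add: less_top)
qed

end

theory Submission
  imports Defs "HOL-Complex_Analysis.Great_Picard"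
begin

text \<open>Put \<open>\<theta> c = V (cball 0 c)\<close>. Subtracting \<open>\<integral> \<theta> (\<rho>\<^sub>K) dm\<close> from \<open>V\<close> leaves a rotation invariant, radial
  continuous valuation \<open>W\<close> that vanishes on all balls around the origin, and it remains to see that
  \<open>W \<le> 0\<close>, the same being true of \<open>- W\<close>. The star bodies with the same bound and the same modulus
  of continuity as a given \<open>K\<close> form a compact class that is closed under unions, intersections and
  rotations. On this class \<open>W\<close> has a maximum \<open>M\<close>, and by the valuation property the union of two
  maximizers is again a maximizer. So the union of finitely many rotated copies of a maximizer
  \<open>K\<^sub>0\<close> is a maximizer; such unions come uniformly close to a ball of radius \<open>max \<rho>\<close>, \<open>\<rho>\<close> being the
  radial function of \<open>K\<^sub>0\<close>. Hence \<open>M = 0\<close>.\<close>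

section \<open>Star sets and star bodies described by their radial functions\<close>

text \<open>Pulled back along \<open>c \<mapsto> c t\<close>, the segment cut out of the line
  through \<open>t\<close> becomes a closed real interval containing 0. The supremum in
  \<open>radial_function\<close> is therefore attained, as the right endpoint of this
  interval.\<close>

lemma star_set_ray:
  fixes K :: "(real ^ 'n) set"
  assumes K: "star_set K" and t: "t \<in> sphere 0 1"
  shows radial_function_nonneg: "0 \<le> radial_function K t"
    and scaleR_mem_iff_le_radial_function: "0 \<le> c \<Longrightarrow> c *\<^sub>R t \<in> K \<longleftrightarrow> c \<le> radial_function K t"
proof -
  from t have t0: "t \<noteq> 0" by auto
  obtain a b where seg: "K \<inter> span {t} = closed_segment a b" and K0: "0 \<in> K"
    using K t0 by (auto simp: star_set_def)
  have "a \<in> span {t}" "b \<in> span {t}"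
    using seg by (metis IntD2 ends_in_segment)+
  then obtain \<alpha> \<beta> where ab: "a = \<alpha> *\<^sub>R t" "b = \<beta> *\<^sub>R t"
    by (auto simp: span_singleton)
  have "linear (\<lambda>c. c *\<^sub>R t)" by (simp add: linear_scaleR_left)
  then have "closed_segment a b = (\<lambda>c. c *\<^sub>R t) ` closed_segment \<alpha> \<beta>"
    unfolding ab by (rule closed_segment_linear_image)
  moreover have "c *\<^sub>R t \<in> K \<longleftrightarrow> c *\<^sub>R t \<in> K \<inter> span {t}" for c
    by (simp add: span_base span_mul)
  ultimately have mem: "c *\<^sub>R t \<in> K \<longleftrightarrow> min \<alpha> \<beta> \<le> c \<and> c \<le> max \<alpha> \<beta>" for c
    using t0 unfolding seg by (auto simp: closed_segment_eq_real_ivl image_iff)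
  have m0: "min \<alpha> \<beta> \<le> 0 \<and> 0 \<le> max \<alpha> \<beta>"
    using mem[of 0] K0 by simp
  have "{c. 0 \<le> c \<and> c *\<^sub>R t \<in> K} = {0..max \<alpha> \<beta>}"
    unfolding mem using m0 by auto
  then have "radial_function K t = max \<alpha> \<beta>"
    unfolding radial_function_def using m0 by simp
  then show "0 \<le> radial_function K t" "0 \<le> c \<Longrightarrow> c *\<^sub>R t \<in> K \<longleftrightarrow> c \<le> radial_function K t"
    using m0 by (auto simp: mem)
qed

text \<open>The criterion by which all star bodies below are recognised and their radial functions
  computed: \<open>mem\<close> says that \<open>K\<close> meets each ray in an initial segment of
  length \<open>f t\<close>, and two opposite rays fit together to a segment through the
  origin.\<close>

lemma
  fixes K :: "(real ^ 'n) set" and f :: "real ^ 'n \<Rightarrow> real"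
  assumes cont: "continuous_on (sphere 0 1) f"
    and nonneg: "\<And>t. t \<in> sphere 0 1 \<Longrightarrow> 0 \<le> f t"
    and mem: "\<And>t c. t \<in> sphere 0 1 \<Longrightarrow> 0 \<le> c \<Longrightarrow> c *\<^sub>R t \<in> K \<longleftrightarrow> c \<le> f t"
  shows star_bodyI: "star_body K"
    and radial_function_eqI: "t \<in> sphere 0 1 \<Longrightarrow> radial_function K t = f t"
proof -
  have rad: "radial_function K t = f t" if t: "t \<in> sphere 0 1" for t
  proof -
    have "{c. 0 \<le> c \<and> c *\<^sub>R t \<in> K} = {0..f t}"
      using mem[OF t] by auto
    then show ?thesis unfolding radial_function_def using nonneg[OF t] by simp
  qed
  then show "t \<in> sphere 0 1 \<Longrightarrow> radial_function K t = f t" .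
  have "\<exists>a b. K \<inter> span {u} = closed_segment a b" if u: "u \<noteq> 0" for u
  proof -
    define t where "t = sgn u"
    have t: "t \<in> sphere 0 1" "- t \<in> sphere 0 1" using u by (auto simp: t_def norm_sgn)
    have "u \<in> span {t}"
      using span_mul[OF span_base, of t "{t}" "norm u"] u by (simp add: t_def sgn_div_norm)
    moreover have "t \<in> span {u}"
      by (simp add: t_def sgn_div_norm span_base span_mul)
    ultimately have span: "span {u} = span {t}"
      using span_eq[of "{u}" "{t}"] by simp
    \<comment> \<open>Points with negative \<open>c\<close> lie on the ray through
      \<open>- t\<close>, which explains the left endpoint \<open>- f (- t)\<close>.\<close>
    have line: "c *\<^sub>R t \<in> K \<longleftrightarrow> c \<in> closed_segment (- f (- t)) (f t)" for c
    proof (cases "0 \<le> c")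
      case True
      then show ?thesis
        using mem[OF t(1), of c] nonneg[OF t(1)] nonneg[OF t(2)] by (auto simp: closed_segment_eq_real_ivl)
    next
      case False
      then show ?thesis
        using mem[OF t(2), of "- c"] nonneg[OF t(1)] nonneg[OF t(2)] by (auto simp: closed_segment_eq_real_ivl)
    qed
    have "K \<inter> span {t} = (\<lambda>c. c *\<^sub>R t) ` closed_segment (- f (- t)) (f t)"
      using line by (auto simp: span_singleton)
    also have "\<dots> = closed_segment ((- f (- t)) *\<^sub>R t) (f t *\<^sub>R t)"
      by (rule closed_segment_linear_image[symmetric]) (simp add: linear_scaleR_left)
    finally show ?thesis using span by auto
  qed
  \<comment> \<open>Any unit vector would do here; \<open>axis undefined 1\<close> is an arbitrary
    one.\<close>
  moreover have "0 \<in> K"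
    using mem[of "axis undefined 1" 0] nonneg[of "axis undefined 1"] by simp
  moreover have "continuous_on (sphere 0 1) (radial_function K)"
    using cont by (rule continuous_on_eq) (simp add: rad)
  ultimately show "star_body K"
    by (simp add: star_body_def star_set_def)
qed

lemma star_body_continuous_on: "star_body K \<Longrightarrow> continuous_on (sphere 0 1) (radial_function K)"
  by (simp add: star_body_def)

lemma star_body_nonneg: "star_body K \<Longrightarrow> t \<in> sphere 0 1 \<Longrightarrow> 0 \<le> radial_function K t"
  by (simp add: star_body_def radial_function_nonneg)

lemma star_body_mem_iff:
  "star_body K \<Longrightarrow> t \<in> sphere 0 1 \<Longrightarrow> 0 \<le> c \<Longrightarrow> c *\<^sub>R t \<in> K \<longleftrightarrow> c \<le> radial_function K t"
  by (simp add: star_body_def scaleR_mem_iff_le_radial_function)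

text \<open>On each ray both bodies are initial segments, so the longer one is the union and the
  shorter one the intersection. This turns the valuation identity into a statement about
  \<open>max\<close> and \<open>min\<close> of functions.\<close>

lemma
  fixes K L :: "(real ^ 'n) set"
  assumes K: "star_body K" and L: "star_body L"
  shows star_body_Un: "star_body (K \<union> L)"
    and radial_function_Un:
      "t \<in> sphere 0 1 \<Longrightarrow> radial_function (K \<union> L) t = max (radial_function K t) (radial_function L t)"
    and star_body_Int: "star_body (K \<inter> L)"
    and radial_function_Int:
      "t \<in> sphere 0 1 \<Longrightarrow> radial_function (K \<inter> L) t = min (radial_function K t) (radial_function L t)"
proof -
  note facts = star_body_continuous_on star_body_nonneg star_body_mem_iff
  note facts = facts[OF K] facts[OF L]
  have *: "continuous_on (sphere 0 1) (\<lambda>t. max (radial_function K t) (radial_function L t))"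
    "continuous_on (sphere 0 1) (\<lambda>t. min (radial_function K t) (radial_function L t))"
    using facts(1,4) by (auto intro: continuous_intros)
  show "star_body (K \<union> L)"
    by (rule star_bodyI[OF *(1)]) (use facts in \<open>auto simp: le_max_iff_disj\<close>)
  show "star_body (K \<inter> L)"
    by (rule star_bodyI[OF *(2)]) (use facts in auto)
  show "t \<in> sphere 0 1 \<Longrightarrow> radial_function (K \<union> L) t = max (radial_function K t) (radial_function L t)"
    by (rule radial_function_eqI[OF *(1)]) (use facts in \<open>auto simp: le_max_iff_disj\<close>)
  show "t \<in> sphere 0 1 \<Longrightarrow> radial_function (K \<inter> L) t = min (radial_function K t) (radial_function L t)"
    by (rule radial_function_eqI[OF *(2)]) (use facts in auto)
qed

declare transpose_matrix_vector [simp del]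

lemma rotation_matrix_transpose:
  fixes A :: "real ^ 'n ^ 'n"
  assumes A: "rotation_matrix A"
  shows "A *v (transpose A *v x) = x" "transpose A *v (A *v x) = x"
    and "norm (A *v x) = norm x" "norm (transpose A *v x) = norm x"
proof -
  have "orthogonal_matrix A" using A by (simp add: rotation_matrix_def)
  then show 1: "A *v (transpose A *v x) = x" "transpose A *v (A *v x) = x" for x
    by (simp_all add: matrix_vector_mul_assoc orthogonal_matrix_def)
  have "orthogonal_transformation ((*v) A)"
    using \<open>orthogonal_matrix A\<close> by (simp add: orthogonal_transformation_matrix)
  then show 2: "norm (A *v x) = norm x" for x
    by (rule orthogonal_transformation_norm)
  show "norm (transpose A *v x) = norm x"
    using 2[of "transpose A *v x"] 1 by simp
qed

text \<open>The transpose of a rotation is its inverse, so a point lies in the rotated body exactly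
  when the transpose carries it back into \<open>L\<close>.\<close>

lemma
  fixes L :: "(real ^ 'n) set"
  assumes L: "star_body L" and A: "rotation_matrix A"
  shows star_body_rotation: "star_body ((\<lambda>x. A *v x) ` L)"
    and radial_function_rotation:
      "t \<in> sphere 0 1 \<Longrightarrow> radial_function ((\<lambda>x. A *v x) ` L) t = radial_function L (transpose A *v t)"
proof -
  note R = rotation_matrix_transpose[OF A]
  have cont: "continuous_on (sphere 0 1) (\<lambda>t. radial_function L (transpose A *v t))"
    by (rule continuous_on_compose2[OF star_body_continuous_on[OF L] matrix_vector_mult_linear_continuous_on])
      (auto simp: R)
  have mem: "c *\<^sub>R t \<in> (\<lambda>x. A *v x) ` L \<longleftrightarrow> c \<le> radial_function L (transpose A *v t)"
    if "t \<in> sphere 0 1" "0 \<le> c" for c t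
  proof -
    have "c *\<^sub>R t \<in> (\<lambda>x. A *v x) ` L \<longleftrightarrow> transpose A *v (c *\<^sub>R t) \<in> L"
    proof
      assume "transpose A *v (c *\<^sub>R t) \<in> L"
      then show "c *\<^sub>R t \<in> (\<lambda>x. A *v x) ` L" by (rule rev_image_eqI) (simp add: R)
    qed (auto simp: R)
    also have "transpose A *v (c *\<^sub>R t) = c *\<^sub>R (transpose A *v t)"
      by (simp add: matrix_vector_mult_scaleR)
    finally show ?thesis using star_body_mem_iff[OF L] that R by simp
  qed
  have nn: "0 \<le> radial_function L (transpose A *v t)" if "t \<in> sphere 0 1" for t
    using star_body_nonneg[OF L] that R by simp
  show "star_body ((\<lambda>x. A *v x) ` L)"
    by (rule star_bodyI[OF cont nn mem])
  show "t \<in> sphere 0 1 \<Longrightarrow> radial_function ((\<lambda>x. A *v x) ` L) t = radial_function L (transpose A *v t)"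
    by (rule radial_function_eqI[OF cont nn mem])
qed

text \<open>Needed to turn a uniform limit of radial functions, which is a priori only a function,
  back into a star body.\<close>

lemma
  fixes f :: "real ^ 'n \<Rightarrow> real"
  assumes cont: "continuous_on (sphere 0 1) f"
    and nonneg: "\<And>t. t \<in> sphere 0 1 \<Longrightarrow> 0 \<le> f t"
  shows ex_star_body: "\<exists>K. star_body K \<and> (\<forall>t\<in>sphere 0 1. radial_function K t = f t)"
proof -
  \<comment> \<open>The origin is added by hand because \<open>sgn 0 = 0\<close> lies off the
    sphere, where nothing is known about \<open>f\<close>.\<close>
  define K where "K = {x. norm x \<le> f (sgn x)} \<union> {0}"
  have mem: "c *\<^sub>R t \<in> K \<longleftrightarrow> c \<le> f t" if "t \<in> sphere 0 1" "0 \<le> c" for c t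
    using that nonneg[of t] by (cases "c = 0") (auto simp: K_def sgn_scaleR sgn_div_norm[of t])
  show ?thesis
    using star_bodyI[OF cont nonneg mem] radial_function_eqI[OF cont nonneg mem] by blast
qed

lemma
  fixes c :: real
  assumes "0 \<le> c"
  shows star_body_cball: "star_body (cball 0 c :: (real ^ 'n) set)"
    and radial_function_cball: "t \<in> sphere 0 1 \<Longrightarrow> radial_function (cball 0 c :: (real ^ 'n) set) t = c"
proof -
  have *: "continuous_on (sphere 0 1) (\<lambda>_ :: real ^ 'n. c)" by simp
  show "star_body (cball 0 c :: (real ^ 'n) set)"
    by (rule star_bodyI[OF *]) (use assms in auto)
  show "t \<in> sphere 0 1 \<Longrightarrow> radial_function (cball 0 c :: (real ^ 'n) set) t = c"
    by (rule radial_function_eqI[OF *]) (use assms in auto)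
qed

section \<open>The radial metric\<close>

text \<open>A continuous function on the compact sphere is bounded, so the supremum defining
  \<open>radial_dist\<close> is a genuine upper bound.\<close>

lemma abs_radial_function_diff_le_radial_dist:
  fixes K L :: "(real ^ 'n) set"
  assumes K: "star_body K" and L: "star_body L" and t: "t \<in> sphere 0 1"
  shows "\<bar>radial_function K t - radial_function L t\<bar> \<le> radial_dist K L"
proof -
  have "continuous_on (sphere 0 1) (\<lambda>t. \<bar>radial_function K t - radial_function L t\<bar>)"
    using K L by (intro continuous_intros star_body_continuous_on)
  then have "bdd_above ((\<lambda>t. \<bar>radial_function K t - radial_function L t\<bar>) ` sphere 0 1)"
    by (intro bounded_imp_bdd_above compact_imp_bounded compact_continuous_image) auto
  then show ?thesis unfolding radial_dist_def using t by (rule cSUP_upper2) auto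
qed

lemma radial_dist_le:
  fixes K L :: "(real ^ 'n) set"
  assumes "\<And>t. t \<in> sphere 0 1 \<Longrightarrow> \<bar>radial_function K t - radial_function L t\<bar> \<le> e"
  shows "radial_dist K L \<le> e"
  unfolding radial_dist_def by (rule cSUP_least) (use assms in auto)

lemma radial_continuous_tendsto:
  fixes V :: "(real ^ 'n) set \<Rightarrow> real"
  assumes V: "radial_continuous V" and K: "star_body K" and X: "\<And>n. star_body (X n)"
    and lim: "uniform_limit (sphere 0 1) (\<lambda>n. radial_function (X n)) (radial_function K) sequentially"
  shows "(\<lambda>n. V (X n)) \<longlonglongrightarrow> V K"
proof (rule tendstoI)
  fix e :: real assume "0 < e"
  then obtain d where d: "d > 0" "\<And>L. star_body L \<Longrightarrow> radial_dist K L < d \<Longrightarrow> \<bar>V L - V K\<bar> < e"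
    using V K unfolding radial_continuous_def by blast
  \<comment> \<open>Strict pointwise bounds give only a weak bound for the supremum; with
    \<open>d / 2\<close> it still stays below \<open>d\<close>.\<close>
  have "\<forall>\<^sub>F n in sequentially. \<forall>t\<in>sphere 0 1. dist (radial_function (X n) t) (radial_function K t) < d / 2"
    using lim d(1) unfolding uniform_limit_iff by (meson half_gt_zero)
  then show "\<forall>\<^sub>F n in sequentially. dist (V (X n)) (V K) < e"
  proof eventually_elim
    case (elim n)
    have "radial_dist K (X n) \<le> d / 2"
      by (rule radial_dist_le) (use elim in \<open>fastforce simp: dist_real_def abs_minus_commute\<close>)
    then show ?case using d X by (simp add: dist_real_def)
  qed
qed

section \<open>Invariance of Lebesgue measure and of the sphere measure under orthogonal
  maps\<close>

text \<open>The substitution is affine with scale factor -1, so its Jacobian has absolute value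
  1.\<close>

lemma nn_integral_lborel_reflect:
  fixes f :: "'a::euclidean_space \<Rightarrow> ennreal"
  assumes [measurable]: "f \<in> borel_measurable borel"
  shows "(\<integral>\<^sup>+ x. f (y - x) \<partial>lborel) = (\<integral>\<^sup>+ x. f x \<partial>lborel)"
proof -
  have "lborel = distr lborel borel (\<lambda>x. y - x)"
    using lborel_affine[of "-1" y] by (simp add: density_1)
  then have "(\<integral>\<^sup>+ x. f x \<partial>lborel) = (\<integral>\<^sup>+ x. f x \<partial>distr lborel borel (\<lambda>x. y - x))"
    by simp
  then show ?thesis by (simp add: nn_integral_distr)
qed

lemma nn_integral_lborel_shift:
  fixes f :: "'a::euclidean_space \<Rightarrow> ennreal"
  assumes [measurable]: "f \<in> borel_measurable borel"
  shows "(\<integral>\<^sup>+ x. f (x - y) \<partial>lborel) = (\<integral>\<^sup>+ x. f x \<partial>lborel)"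
proof -
  have "(\<integral>\<^sup>+ x. f x \<partial>lborel) = (\<integral>\<^sup>+ x. f x \<partial>distr lborel borel ((+) (- y)))"
    by (simp add: lborel_distr_plus)
  then show ?thesis by (simp add: nn_integral_distr)
qed

text \<open>The library has this for index types with a well-order only. For arbitrary \<open>f\<close> and \<open>g\<close>, the
  substitutions \<open>y \<leadsto> y - T x\<close> and \<open>x \<leadsto> T\<^sup>-\<^sup>1 y - x\<close> in \<open>\<integral>\<integral> f (T x) g y\<close> give
  \<open>\<integral>(f \<circ> T) \<integral>g = \<integral>(g \<circ> T) \<integral>f\<close>; now take for \<open>g\<close> the indicator of the ball.\<close>

lemma nn_integral_lborel_orthogonal:
  fixes f :: "'a::euclidean_space \<Rightarrow> ennreal" and T :: "'a \<Rightarrow> 'a"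
  assumes T: "orthogonal_transformation T" and [measurable]: "f \<in> borel_measurable borel"
  shows "(\<integral>\<^sup>+ x. f (T x) \<partial>lborel) = (\<integral>\<^sup>+ x. f x \<partial>lborel)"
proof -
  have lin: "linear T" using T by (rule orthogonal_transformation_linear)
  have [measurable]: "T \<in> borel_measurable borel"
    using lin by (intro borel_measurable_continuous_onI) (simp add: linear_continuous_on linear_linear)
  have TS: "T (inv T y) = y" for y
    using orthogonal_transformation_surj[OF T] by (rule surj_f_inv_f)
  define g :: "'a \<Rightarrow> ennreal" where "g = indicator (cball 0 1)"
  have [measurable]: "g \<in> borel_measurable borel"
    unfolding g_def by (intro borel_measurable_indicator) simp
  have gT: "g (T x) = g x" for x
    using T by (simp add: g_def indicator_def orthogonal_transformation_norm)
  have "(\<integral>\<^sup>+ x. f (T x) \<partial>lborel) * (\<integral>\<^sup>+ y. g y \<partial>lborel)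
      = (\<integral>\<^sup>+ x. f (T x) * (\<integral>\<^sup>+ y. g (y - T x) \<partial>lborel) \<partial>lborel)"
    by (simp add: nn_integral_lborel_shift nn_integral_multc)
  also have "\<dots> = (\<integral>\<^sup>+ x. (\<integral>\<^sup>+ y. f (T x) * g (y - T x) \<partial>lborel) \<partial>lborel)"
    by (simp add: nn_integral_cmult)
  also have "\<dots> = (\<integral>\<^sup>+ y. (\<integral>\<^sup>+ x. f (T x) * g (y - T x) \<partial>lborel) \<partial>lborel)"
    by (rule lborel_pair.Fubini') simp
  also have "\<dots> = (\<integral>\<^sup>+ y. (\<integral>\<^sup>+ x. f (T (inv T y - x)) * g (y - T (inv T y - x)) \<partial>lborel) \<partial>lborel)"
    by (intro nn_integral_cong nn_integral_lborel_reflect[symmetric]) simp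
  also have "\<dots> = (\<integral>\<^sup>+ y. (\<integral>\<^sup>+ x. f (y - T x) * g x \<partial>lborel) \<partial>lborel)"
    by (simp add: linear_diff[OF lin] TS gT)
  also have "\<dots> = (\<integral>\<^sup>+ x. (\<integral>\<^sup>+ y. f (y - T x) * g x \<partial>lborel) \<partial>lborel)"
    by (rule lborel_pair.Fubini') simp
  also have "\<dots> = (\<integral>\<^sup>+ x. f x \<partial>lborel) * (\<integral>\<^sup>+ x. g x \<partial>lborel)"
    by (simp add: nn_integral_multc nn_integral_cmult nn_integral_lborel_shift)
  finally have eq: "(\<integral>\<^sup>+ x. f (T x) \<partial>lborel) * (\<integral>\<^sup>+ y. g y \<partial>lborel)
      = (\<integral>\<^sup>+ x. f x \<partial>lborel) * (\<integral>\<^sup>+ x. g x \<partial>lborel)" .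
  \<comment> \<open>The unit ball has positive finite volume, so this factor cancels from
    \<open>eq\<close>.\<close>
  have "(\<integral>\<^sup>+ x. g x \<partial>lborel) = emeasure lborel (cball 0 1 :: 'a set)"
    by (simp add: g_def)
  moreover have "emeasure lborel (cball 0 1 :: 'a set) \<noteq> 0"
    using content_cball_pos[of 1 "0 :: 'a"] by (auto simp: measure_def)
  moreover have "emeasure lborel (cball 0 1 :: 'a set) \<noteq> \<infinity>"
    using emeasure_lborel_cball_finite[of "0 :: 'a" 1] by auto
  ultimately show ?thesis
    using eq by (simp add: mult.commute[of _ "emeasure _ _"] ennreal_mult_cancel_left)
qed

lemma finite_measure_sphere_measure: "finite_measure (sphere_measure :: (real ^ 'n) measure)"
  by (rule finite_measureI) (simp add: space_sphere_measure emeasure_sphere_measure_sphere)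

lemma borel_measurable_sphere_measure:
  fixes f :: "real ^ 'n \<Rightarrow> real"
  assumes "continuous_on (sphere 0 1) f"
  shows "f \<in> borel_measurable sphere_measure"
  using borel_measurable_continuous_on_restrict[OF assms]
  by (simp add: measurable_cong_sets[OF sets_sphere_measure refl])

lemma integrable_sphere_measure:
  fixes f :: "real ^ 'n \<Rightarrow> real"
  assumes f: "continuous_on (sphere 0 1) f"
  shows "integrable sphere_measure f"
proof -
  interpret finite_measure "sphere_measure :: (real ^ 'n) measure" by (rule finite_measure_sphere_measure)
  have "bounded (f ` sphere 0 1)"
    using f by (intro compact_imp_bounded compact_continuous_image) auto
  then obtain B where "\<And>t. t \<in> sphere 0 1 \<Longrightarrow> norm (f t) \<le> B"
    unfolding bounded_iff by blast
  then show ?thesis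
    by (intro integrable_const_bound[of f B] borel_measurable_sphere_measure f AE_I2) (simp add: space_sphere_measure)
qed

text \<open>\<open>sgn\<close> commutes with \<open>T\<close>, so the cone over a preimage under
  \<open>T\<close> is the preimage of the cone. Invariance of Lebesgue measure then shows that
  \<open>T\<close> pushes the sphere measure forward to itself, and the claim is a change of
  variables.\<close>

lemma integral_sphere_measure_orthogonal:
  fixes f :: "real ^ 'n \<Rightarrow> real" and T :: "real ^ 'n \<Rightarrow> real ^ 'n"
  assumes T: "orthogonal_transformation T" and f: "continuous_on (sphere 0 1) f"
  shows "(\<integral>t. f (T t) \<partial>sphere_measure) = (\<integral>t. f t \<partial>sphere_measure)"
proof -
  have lin: "linear T" using T by (rule orthogonal_transformation_linear)
  have T_borel: "T \<in> borel_measurable borel"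
    using lin by (intro borel_measurable_continuous_onI) (simp add: linear_continuous_on linear_linear)
  have T_norm: "norm (T x) = norm x" for x using T by (rule orthogonal_transformation_norm)
  have sgn_T: "sgn (T x) = T (sgn x)" for x
    by (simp add: sgn_div_norm T_norm linear_scale[OF lin])
  have T_meas: "T \<in> measurable sphere_measure sphere_measure"
    unfolding measurable_cong_sets[OF sets_sphere_measure sets_sphere_measure]
    using T_borel by (intro measurable_restrict_space3) (auto simp: T_norm)
  \<comment> \<open>In this form the cone is visibly Borel, and preimages under \<open>T\<close> can
    be compared point by point.\<close>
  have cone: "{r *\<^sub>R t | r t. 0 < r \<and> r \<le> 1 \<and> t \<in> A} = cball 0 1 \<inter> sgn -` A"
    if "A \<subseteq> sphere 0 1" for A :: "(real ^ 'n) set"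
  proof (intro equalityI subsetI)
    fix x assume x: "x \<in> cball 0 1 \<inter> sgn -` A"
    then have "x \<noteq> 0" using that by auto
    then show "x \<in> {r *\<^sub>R t | r t. 0 < r \<and> r \<le> 1 \<and> t \<in> A}"
      using x by (auto intro!: exI[of _ "norm x"] exI[of _ "sgn x"] simp: sgn_div_norm)
  next
    fix x assume "x \<in> {r *\<^sub>R t | r t. 0 < r \<and> r \<le> 1 \<and> t \<in> A}"
    then obtain r t where x: "x = r *\<^sub>R t" "0 < r" "r \<le> 1" "t \<in> A" by auto
    then have "norm t = 1" using that by auto
    then show "x \<in> cball 0 1 \<inter> sgn -` A" using x by (simp add: sgn_scaleR sgn_div_norm)
  qed
  have "distr sphere_measure sphere_measure T = (sphere_measure :: (real ^ 'n) measure)"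
  proof (rule measure_eqI)
    fix A :: "(real ^ 'n) set"
    assume "A \<in> sets (distr sphere_measure sphere_measure T)"
    then have A: "A \<in> sets sphere_measure" by simp
    then have A': "A \<in> sets borel" "A \<subseteq> sphere 0 1"
      by (auto simp: sets_sphere_measure sets_restrict_space_iff)
    define B where "B = T -` A \<inter> sphere 0 1"
    have B: "B \<in> sets borel" "B \<subseteq> sphere 0 1"
      using measurable_sets_borel[OF T_borel A'(1)] by (auto simp: B_def)
    have "cball 0 1 \<inter> sgn -` B = {x. T x \<in> cball 0 1 \<inter> sgn -` A}"
      using A'(2) by (auto simp: B_def sgn_T T_norm)
    then have "(indicator (cball 0 1 \<inter> sgn -` B) :: _ \<Rightarrow> ennreal) = (\<lambda>x. indicator (cball 0 1 \<inter> sgn -` A) (T x))"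
      by (auto simp: indicator_def fun_eq_iff)
    moreover have "cball 0 1 \<inter> sgn -` C \<in> sets borel" if "C \<in> sets borel" for C :: "(real ^ 'n) set"
      using measurable_sets_borel[OF borel_measurable_sgn that] by auto
    ultimately have "emeasure lborel (cball 0 1 \<inter> sgn -` B) = emeasure lborel (cball 0 1 \<inter> sgn -` A)"
      using nn_integral_lborel_orthogonal[OF T, of "indicator (cball 0 1 \<inter> sgn -` A)"] A'(1) B(1)
      by (metis borel_measurable_indicator nn_integral_indicator sets_lborel)
    moreover have "emeasure (distr sphere_measure sphere_measure T) A = emeasure sphere_measure B"
      using A T_meas by (simp add: emeasure_distr B_def space_sphere_measure)
    ultimately show "emeasure (distr sphere_measure sphere_measure T) A = emeasure sphere_measure A"
      by (simp add: emeasure_sphere_measure A' B cone)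
  qed simp
  then have "(\<integral>t. f t \<partial>sphere_measure) = (\<integral>t. f t \<partial>distr sphere_measure sphere_measure T)"
    by simp
  also have "\<dots> = (\<integral>t. f (T t) \<partial>sphere_measure)"
    using T_meas borel_measurable_sphere_measure[OF f] by (rule integral_distr)
  finally show ?thesis by simp
qed

section \<open>The converse: integrals of \<theta> over the sphere\<close>

text \<open>The valuation identity holds already under the integral, since at each \<open>t\<close>
  the radial functions of union and intersection take the same two values as those of
  \<open>K\<close> and \<open>L\<close>, up to order. Rotation invariance comes from that of the
  measure, radial continuity from uniform continuity of \<theta> on bounded intervals.\<close>

lemma
  fixes \<theta> :: "real \<Rightarrow> real" and V :: "(real ^ 'n) set \<Rightarrow> real"
  assumes \<theta>: "continuous_on {0..} \<theta>"
    and V: "\<And>K. star_body K \<Longrightarrow> V K = (\<integral>t. \<theta> (radial_function K t) \<partial>sphere_measure)"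
  shows radial_continuous_integral: "radial_continuous V"
    and rotation_invariant_integral: "rotation_invariant V"
    and valuation_integral: "valuation V"
proof -
  have cont: "continuous_on (sphere 0 1) (\<lambda>t. \<theta> (radial_function K t))" if "star_body K" for K :: "(real ^ 'n) set"
    by (rule continuous_on_compose2[OF \<theta> star_body_continuous_on[OF that]]) (use star_body_nonneg[OF that] in auto)
  note int = integrable_sphere_measure[OF cont]
  show "valuation V"
    unfolding valuation_def
  proof (intro allI impI)
    fix K L :: "(real ^ 'n) set" assume K: "star_body K" and L: "star_body L"
    note KL = star_body_Un[OF K L] star_body_Int[OF K L]
    have "V (K \<union> L) + V (K \<inter> L) = (\<integral>t. \<theta> (radial_function (K \<union> L) t) + \<theta> (radial_function (K \<inter> L) t) \<partial>sphere_measure)"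
      using V KL int by simp
    also have "\<dots> = (\<integral>t. \<theta> (radial_function K t) + \<theta> (radial_function L t) \<partial>sphere_measure)"
    proof (rule Bochner_Integration.integral_cong[OF refl])
      fix t :: "real ^ 'n" assume "t \<in> space sphere_measure"
      then have "t \<in> sphere 0 1" by (simp add: space_sphere_measure)
      then show "\<theta> (radial_function (K \<union> L) t) + \<theta> (radial_function (K \<inter> L) t)
          = \<theta> (radial_function K t) + \<theta> (radial_function L t)"
        by (simp add: radial_function_Un[OF K L] radial_function_Int[OF K L] max_def min_def)
    qed
    also have "\<dots> = V K + V L"
      using V K L int by simp
    finally show "V (K \<union> L) + V (K \<inter> L) = V K + V L" .
  qed
  show "rotation_invariant V"
    unfolding rotation_invariant_def
  proof (intro allI impI)
    fix L :: "(real ^ 'n) set" and A :: "real ^ 'n ^ 'n"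
    assume L: "star_body L" and A: "rotation_matrix A"
    have T: "orthogonal_transformation ((*v) (transpose A))"
      using A by (simp add: orthogonal_transformation_matrix rotation_matrix_def orthogonal_matrix_transpose)
    have "V ((\<lambda>x. A *v x) ` L) = (\<integral>t. \<theta> (radial_function L (transpose A *v t)) \<partial>sphere_measure)"
      unfolding V[OF star_body_rotation[OF L A]]
      by (rule Bochner_Integration.integral_cong[OF refl])
        (simp add: space_sphere_measure radial_function_rotation[OF L A])
    also have "\<dots> = V L"
      unfolding V[OF L] by (rule integral_sphere_measure_orthogonal[OF T cont[OF L]])
    finally show "V ((\<lambda>x. A *v x) ` L) = V L" .
  qed
  show "radial_continuous V"
    unfolding radial_continuous_def
  proof (intro allI impI)
    fix K :: "(real ^ 'n) set" and e :: real assume K: "star_body K" and e: "e > 0"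
    have "bounded (radial_function K ` sphere 0 1)"
      using star_body_continuous_on[OF K] by (intro compact_imp_bounded compact_continuous_image) auto
    then obtain R where R: "\<And>t. t \<in> sphere 0 1 \<Longrightarrow> \<bar>radial_function K t\<bar> \<le> R"
      unfolding bounded_iff real_norm_def by blast
    \<comment> \<open>A body at distance less than 1 from \<open>K\<close> has radial function at
      most \<open>R + 1\<close>, so one compact interval serves all bodies near \<open>K\<close>.
      This is the reason for the 1 in \<open>min d 1\<close> below.\<close>
    have "uniformly_continuous_on {0..R + 1} \<theta>"
      by (intro compact_uniformly_continuous continuous_on_subset[OF \<theta>]) auto
    then obtain d where d: "d > 0"
        "\<And>x y. x \<in> {0..R + 1} \<Longrightarrow> y \<in> {0..R + 1} \<Longrightarrow> dist x y < d \<Longrightarrow> dist (\<theta> x) (\<theta> y) < e / 2"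
      unfolding uniformly_continuous_on_def using e half_gt_zero by metis
    show "\<exists>\<delta>>0. \<forall>L. star_body L \<longrightarrow> radial_dist K L < \<delta> \<longrightarrow> \<bar>V L - V K\<bar> < e"
    proof (intro exI[of _ "min d 1"] conjI allI impI)
      fix L :: "(real ^ 'n) set" assume L: "star_body L" and KL: "radial_dist K L < min d 1"
      have bound: "\<bar>\<theta> (radial_function L t) - \<theta> (radial_function K t)\<bar> \<le> e / 2"
        if t: "t \<in> sphere 0 1" for t
      proof -
        have "\<bar>radial_function K t - radial_function L t\<bar> < min d 1"
          using abs_radial_function_diff_le_radial_dist[OF K L t] KL by simp
        then show ?thesis
          using d(2)[of "radial_function L t" "radial_function K t"] R[OF t]
            star_body_nonneg[OF K t] star_body_nonneg[OF L t]
          by (simp add: dist_real_def) linarith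
      qed
      interpret finite_measure "sphere_measure :: (real ^ 'n) measure" by (rule finite_measure_sphere_measure)
      have one: "measure (sphere_measure :: (real ^ 'n) measure) (space sphere_measure) = 1"
        by (simp add: measure_def space_sphere_measure emeasure_sphere_measure_sphere)
      have "\<bar>V L - V K\<bar> = \<bar>\<integral>t. \<theta> (radial_function L t) - \<theta> (radial_function K t) \<partial>sphere_measure\<bar>"
        using V K L int by simp
      also have "\<dots> \<le> (\<integral>t. \<bar>\<theta> (radial_function L t) - \<theta> (radial_function K t)\<bar> \<partial>sphere_measure)"
        by (rule integral_abs_bound)
      also have "\<dots> \<le> (\<integral>t. e / 2 \<partial>(sphere_measure :: (real ^ 'n) measure))"
        using int[OF K] int[OF L] bound by (intro integral_mono) (auto simp: space_sphere_measure)
      also have "\<dots> = e / 2" using one by simp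
      finally show "\<bar>V L - V K\<bar> < e" using e by simp
    qed (use d in simp)
  qed
qed

section \<open>Valuations that vanish on balls\<close>

text \<open>The dimension is at least two so that the rotations act transitively on the sphere,
  which lets rotated copies of a maximizer reach the radius \<open>c\<close> at any prescribed
  point.\<close>

lemma rotation_invariant_valuation_le_0:
  fixes W :: "(real ^ 'n) set \<Rightarrow> real"
  assumes n: "2 \<le> CARD('n)"
    and rot: "rotation_invariant W" and cont: "radial_continuous W" and val: "valuation W"
    and ball: "\<And>c. 0 \<le> c \<Longrightarrow> W (cball 0 c) = 0"
    and K: "star_body K"
  shows "W K \<le> 0"
proof -
  let ?S = "sphere 0 1 :: (real ^ 'n) set"
  let ?\<rho> = "radial_function :: (real ^ 'n) set \<Rightarrow> _"
  have "bounded (?\<rho> K ` ?S)"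
    using star_body_continuous_on[OF K] by (intro compact_imp_bounded compact_continuous_image) auto
  then obtain R where R: "\<And>t. t \<in> ?S \<Longrightarrow> ?\<rho> K t \<le> R"
    unfolding bounded_iff real_norm_def using abs_le_D1 by blast
  have "uniformly_continuous_on ?S (?\<rho> K)"
    by (intro compact_uniformly_continuous star_body_continuous_on K) auto
  then obtain d where d: "\<And>e. e > 0 \<Longrightarrow> d e > 0"
      "\<And>e s t. e > 0 \<Longrightarrow> s \<in> ?S \<Longrightarrow> t \<in> ?S \<Longrightarrow> dist s t < d e \<Longrightarrow> dist (?\<rho> K s) (?\<rho> K t) < e"
    unfolding uniformly_continuous_on_def by metis
  \<comment> \<open>The function \<open>d\<close> is a modulus of continuity of the radial function
    of \<open>K\<close>. The inequalities \<open>\<le> R\<close> and \<open>\<le> e\<close> are weak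
    so that they survive pointwise limits.\<close>
  define \<E> where "\<E> = {L. star_body L \<and> (\<forall>t\<in>?S. ?\<rho> L t \<le> R) \<and>
    (\<forall>e>0. \<forall>s\<in>?S. \<forall>t\<in>?S. dist s t < d e \<longrightarrow> \<bar>?\<rho> L s - ?\<rho> L t\<bar> \<le> e)}"
  have K_\<E>: "K \<in> \<E>"
    using K R d(2) by (fastforce simp: \<E>_def dist_real_def)
  have Un_\<E>: "L \<union> L' \<in> \<E>" if "L \<in> \<E>" "L' \<in> \<E>" for L L'
  proof -
    have "\<bar>max a b - max a' b'\<bar> \<le> e" if "\<bar>a - a'\<bar> \<le> e" "\<bar>b - b'\<bar> \<le> e" for a b a' b' e :: real
      using that by linarith
    then show ?thesis using that by (simp add: \<E>_def star_body_Un radial_function_Un)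
  qed
  have Int_\<E>: "L \<inter> L' \<in> \<E>" if "L \<in> \<E>" "L' \<in> \<E>" for L L'
  proof -
    have "\<bar>min a b - min a' b'\<bar> \<le> e" if "\<bar>a - a'\<bar> \<le> e" "\<bar>b - b'\<bar> \<le> e" for a b a' b' e :: real
      using that by linarith
    then show ?thesis using that by (simp add: \<E>_def star_body_Int radial_function_Int min_le_iff_disj)
  qed
  have rot_\<E>: "(\<lambda>x. A *v x) ` L \<in> \<E>" if L: "L \<in> \<E>" and A: "rotation_matrix A" for L A
  proof -
    note R = rotation_matrix_transpose[OF A]
    \<comment> \<open>Rotations are isometries, so composing with one preserves the modulus
      \<open>d\<close>.\<close>
    have "dist (transpose A *v s) (transpose A *v t) = dist s t" for s t
      using R(4)[of "s - t"] by (simp add: dist_norm matrix_vector_mult_diff_distrib)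
    then show ?thesis using L A by (auto simp: \<E>_def star_body_rotation radial_function_rotation R)
  qed
  \<comment> \<open>Only the set of values is shown compact, so no topology on the star bodies is
    required: Arzela-Ascoli gives a uniformly convergent subsequence of radial functions, the limit
    belongs to a body in \<open>\<E>\<close>, and radial continuity carries the convergence over to
    \<open>W\<close>.\<close>
  have "compact (W ` \<E>)"
    unfolding compact_def
  proof (intro allI impI)
    fix f :: "nat \<Rightarrow> real" assume "\<forall>n. f n \<in> W ` \<E>"
    then have "\<forall>n. \<exists>L. L \<in> \<E> \<and> f n = W L" by auto
    then obtain X where X: "\<And>n. X n \<in> \<E>" "\<And>n. f n = W (X n)" by metis
    obtain g k where g: "continuous_on ?S g" and k: "strict_mono (k :: nat \<Rightarrow> nat)"
      and lim: "\<And>e. 0 < e \<Longrightarrow> \<exists>N. \<forall>n x. n \<ge> N \<and> x \<in> ?S \<longrightarrow> norm (?\<rho> (X (k n)) x - g x) < e"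
    proof (rule Arzela_Ascoli[of ?S "\<lambda>n. ?\<rho> (X n)" R])
      show "norm (?\<rho> (X n) x) \<le> R" if "x \<in> ?S" for n x
        using X(1)[of n] that star_body_nonneg[of "X n" x] by (simp add: \<E>_def)
      show "\<exists>d>0. \<forall>n y. y \<in> ?S \<and> norm (x - y) < d \<longrightarrow> norm (?\<rho> (X n) x - ?\<rho> (X n) y) < e"
        if x: "x \<in> ?S" and e: "0 < e" for x e
      \<comment> \<open>Halving \<open>e\<close> turns the weak bound in \<open>\<E>\<close> into
        the strict one asked for.\<close>
      proof (intro exI[of _ "d (e / 2)"] conjI allI impI)
        show "0 < d (e / 2)" using d(1) e by simp
        fix n y assume "y \<in> ?S \<and> norm (x - y) < d (e / 2)"
        then have "\<bar>?\<rho> (X n) x - ?\<rho> (X n) y\<bar> \<le> e / 2"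
          using X(1)[of n] x half_gt_zero[OF e] unfolding \<E>_def dist_norm by blast
        then show "norm (?\<rho> (X n) x - ?\<rho> (X n) y) < e" using e by simp
      qed
    qed auto
    have pointwise: "(\<lambda>n. ?\<rho> (X (k n)) t) \<longlonglongrightarrow> g t" if "t \<in> ?S" for t
      using lim that by (force simp: LIMSEQ_iff)
    have "0 \<le> g t" if "t \<in> ?S" for t
      using pointwise[OF that]
    proof (rule LIMSEQ_le_const)
      have "0 \<le> ?\<rho> (X (k n)) t" for n
        using X(1)[of "k n"] that by (simp add: \<E>_def star_body_nonneg)
      then show "\<exists>N. \<forall>n\<ge>N. 0 \<le> ?\<rho> (X (k n)) t" by blast
    qed
    then obtain L where L: "star_body L" "\<And>t. t \<in> ?S \<Longrightarrow> ?\<rho> L t = g t"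
      using ex_star_body[OF g] by blast
    have "L \<in> \<E>"
      unfolding \<E>_def
    proof (intro CollectI conjI ballI allI impI L(1))
      show "?\<rho> L t \<le> R" if "t \<in> ?S" for t
        unfolding L(2)[OF that] using pointwise[OF that]
        by (rule LIMSEQ_le_const2) (use X(1) that in \<open>auto simp: \<E>_def\<close>)
      show "\<bar>?\<rho> L s - ?\<rho> L t\<bar> \<le> e" if "0 < e" "s \<in> ?S" "t \<in> ?S" "dist s t < d e" for e s t
      proof (rule LIMSEQ_le_const2)
        show "(\<lambda>n. \<bar>?\<rho> (X (k n)) s - ?\<rho> (X (k n)) t\<bar>) \<longlonglongrightarrow> \<bar>?\<rho> L s - ?\<rho> L t\<bar>"
          unfolding L(2)[OF that(2)] L(2)[OF that(3)] by (intro tendsto_intros pointwise that)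
        show "\<exists>N. \<forall>n\<ge>N. \<bar>?\<rho> (X (k n)) s - ?\<rho> (X (k n)) t\<bar> \<le> e"
          using X(1) that unfolding \<E>_def by blast
      qed
    qed
    moreover have "(\<lambda>n. W (X (k n))) \<longlonglongrightarrow> W L"
    proof (rule radial_continuous_tendsto[OF cont L(1)])
      show "star_body (X (k n))" for n using X(1) by (simp add: \<E>_def)
      show "uniform_limit ?S (\<lambda>n. ?\<rho> (X (k n))) (?\<rho> L) sequentially"
        unfolding uniform_limit_sequentially_iff
      proof (intro allI impI)
        fix e :: real assume "0 < e"
        then obtain N where "\<forall>n x. n \<ge> N \<and> x \<in> ?S \<longrightarrow> norm (?\<rho> (X (k n)) x - g x) < e"
          using lim by blast
        then show "\<exists>N. \<forall>n\<ge>N. \<forall>x\<in>?S. dist (?\<rho> (X (k n)) x) (?\<rho> L x) < e"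
          using L(2) unfolding dist_norm by (intro exI[of _ N]) metis
      qed
    qed
    ultimately show "\<exists>l\<in>W ` \<E>. \<exists>r. strict_mono r \<and> (f \<circ> r) \<longlonglongrightarrow> l"
      using k X(2) by (auto simp: o_def)
  qed
  then obtain M where M: "M \<in> W ` \<E>" "\<And>L. L \<in> \<E> \<Longrightarrow> W L \<le> M"
    using compact_attains_sup[of "W ` \<E>"] K_\<E> by auto
  from M(1) obtain K\<^sub>0 where K\<^sub>0: "K\<^sub>0 \<in> \<E>" "W K\<^sub>0 = M" by auto
  have sb: "star_body L" if "L \<in> \<E>" for L using that by (simp add: \<E>_def)
  obtain x\<^sub>0 where x\<^sub>0: "x\<^sub>0 \<in> ?S" "\<And>t. t \<in> ?S \<Longrightarrow> ?\<rho> K\<^sub>0 t \<le> ?\<rho> K\<^sub>0 x\<^sub>0"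
    using continuous_attains_sup[OF _ _ star_body_continuous_on[OF sb[OF K\<^sub>0(1)]]] by auto
  define c where "c = ?\<rho> K\<^sub>0 x\<^sub>0"
  have c0: "0 \<le> c" using star_body_nonneg[OF sb[OF K\<^sub>0(1)] x\<^sub>0(1)] by (simp add: c_def)
  \<comment> \<open>Induction on the finite set \<open>T\<close>: each new point is served by the
    union with one more rotated copy of \<open>K\<^sub>0\<close>. No copy exceeds \<open>c\<close>,
    so the values already reached are kept.\<close>
  have net: "\<exists>L\<in>\<E>. W L = M \<and> (\<forall>t\<in>?S. ?\<rho> L t \<le> c) \<and> (\<forall>y\<in>T. ?\<rho> L y = c)"
    if "finite T" "T \<subseteq> ?S" for T
    using that
  proof induction
    case empty
    then show ?case using K\<^sub>0 x\<^sub>0 c_def by auto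
  next
    case (insert y T)
    then obtain L where L: "L \<in> \<E>" "W L = M" "\<And>t. t \<in> ?S \<Longrightarrow> ?\<rho> L t \<le> c" "\<And>y. y \<in> T \<Longrightarrow> ?\<rho> L y = c"
      by auto
    have y: "y \<in> ?S" using insert by simp
    obtain f where f: "orthogonal_transformation f" "det (matrix f) = 1" "f x\<^sub>0 = y"
      using rotation_exists[OF n, of x\<^sub>0 y] x\<^sub>0(1) y by auto
    define A where "A = matrix f"
    have A: "rotation_matrix A" "A *v x\<^sub>0 = y"
      using f by (auto simp: A_def rotation_matrix_def orthogonal_transformation_matrix matrix_works)
    note R = rotation_matrix_transpose[OF A(1)]
    define L' where "L' = (\<lambda>x. A *v x) ` K\<^sub>0"
    have L': "L' \<in> \<E>" "W L' = M"
      using K\<^sub>0 A(1) rot_\<E> rot sb by (auto simp: L'_def rotation_invariant_def)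
    have \<rho>L': "?\<rho> L' t = ?\<rho> K\<^sub>0 (transpose A *v t)" if "t \<in> ?S" for t
      using that K\<^sub>0(1) A(1) sb by (simp add: L'_def radial_function_rotation)
    have "W (L \<union> L') + W (L \<inter> L') = W L + W L'"
      using val L(1) L'(1) sb unfolding valuation_def by blast
    \<comment> \<open>Both terms on the left are at most \<open>M\<close> and they add up to
      \<open>2 M\<close>, so each equals \<open>M\<close>.\<close>
    then have "W (L \<union> L') = M"
      using M(2)[OF Un_\<E>[OF L(1) L'(1)]] M(2)[OF Int_\<E>[OF L(1) L'(1)]] L(2) L'(2) by simp
    moreover have "?\<rho> (L \<union> L') t \<le> c" if "t \<in> ?S" for t
      using that L L' sb x\<^sub>0(2) R by (simp add: radial_function_Un \<rho>L' c_def)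
    moreover have "?\<rho> (L \<union> L') z = c" if "z \<in> insert y T" for z
    proof -
      have z: "z \<in> ?S" using that insert by auto
      have "?\<rho> L' y = c" using \<rho>L'[OF y] R(2)[of x\<^sub>0] A(2) by (simp add: c_def)
      then have "c \<le> max (?\<rho> L z) (?\<rho> L' z)" using that L(4) by (auto simp: le_max_iff_disj)
      then show ?thesis
        using calculation(2)[OF z] radial_function_Un[OF sb[OF L(1)] sb[OF L'(1)] z] by linarith
    qed
    ultimately show ?case using Un_\<E>[OF L(1) L'(1)] by blast
  qed
  have "\<bar>M\<bar> \<le> 0"
  proof (rule field_le_epsilon)
    fix \<epsilon> :: real assume "0 < \<epsilon>"
    then obtain \<delta> where \<delta>: "\<delta> > 0"
        "\<And>L. star_body L \<Longrightarrow> radial_dist (cball 0 c) L < \<delta> \<Longrightarrow> \<bar>W L - W (cball 0 c)\<bar> < \<epsilon>"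
      using cont star_body_cball[OF c0, where 'n = 'n] unfolding radial_continuous_def by blast
    \<comment> \<open>By compactness finitely many points come within
      \<open>d (\<delta> / 2)\<close> of every point of the sphere. A maximizer with radius
      \<open>c\<close> at these points differs from \<open>c\<close> by at most
      \<open>\<delta> / 2\<close> everywhere, by the modulus of continuity.\<close>
    obtain T where T: "finite T" "T \<subseteq> ?S" "?S \<subseteq> (\<Union>y\<in>T. ball y (d (\<delta> / 2)))"
      using compactE_image[of ?S ?S "\<lambda>y. ball y (d (\<delta> / 2))"] d(1)[of "\<delta> / 2"] \<delta>(1) by force
    obtain L where L: "L \<in> \<E>" "W L = M" "\<And>t. t \<in> ?S \<Longrightarrow> ?\<rho> L t \<le> c" "\<And>y. y \<in> T \<Longrightarrow> ?\<rho> L y = c"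
      using net[OF T(1,2)] by auto
    have "radial_dist (cball 0 c) L \<le> \<delta> / 2"
    proof (rule radial_dist_le)
      fix t assume t: "t \<in> ?S"
      then obtain y where y: "y \<in> T" "dist y t < d (\<delta> / 2)" using T(3) by auto
      then have "\<bar>?\<rho> L y - ?\<rho> L t\<bar> \<le> \<delta> / 2"
        using L(1) T(2) t half_gt_zero[OF \<delta>(1)] unfolding \<E>_def by blast
      then show "\<bar>?\<rho> (cball 0 c) t - ?\<rho> L t\<bar> \<le> \<delta> / 2"
        using L(4)[OF y(1)] radial_function_cball[OF c0 t] by simp
    qed
    then have "\<bar>W L - W (cball 0 c)\<bar> < \<epsilon>"
      using \<delta> sb[OF L(1)] by simp
    then show "\<bar>M\<bar> \<le> 0 + \<epsilon>" using L(2) ball[OF c0] by simp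
  qed
  then show ?thesis using M(2)[OF K_\<E>] by simp
qed

section \<open>Differences of functionals and values on balls\<close>

lemma rotation_invariant_valuation_diff:
  assumes "rotation_invariant V" "rotation_invariant U"
  shows "rotation_invariant (\<lambda>L. V L - U L)"
  using assms by (simp add: rotation_invariant_def)

lemma valuation_diff:
  assumes "valuation V" "valuation U"
  shows "valuation (\<lambda>L. V L - U L)"
  using assms by (simp add: valuation_def) (smt (verit))

lemma radial_continuous_diff:
  fixes V U :: "(real ^ 'n) set \<Rightarrow> real"
  assumes V: "radial_continuous V" and U: "radial_continuous U"
  shows "radial_continuous (\<lambda>L. V L - U L)"
  unfolding radial_continuous_def
proof (intro allI impI)
  fix K :: "(real ^ 'n) set" and e :: real assume K: "star_body K" and e: "e > 0"
  obtain d1 where d1: "d1 > 0" "\<And>L. star_body L \<Longrightarrow> radial_dist K L < d1 \<Longrightarrow> \<bar>V L - V K\<bar> < e / 2"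
    using V K half_gt_zero[OF e] unfolding radial_continuous_def by blast
  obtain d2 where d2: "d2 > 0" "\<And>L. star_body L \<Longrightarrow> radial_dist K L < d2 \<Longrightarrow> \<bar>U L - U K\<bar> < e / 2"
    using U K half_gt_zero[OF e] unfolding radial_continuous_def by blast
  show "\<exists>\<delta>>0. \<forall>L. star_body L \<longrightarrow> radial_dist K L < \<delta> \<longrightarrow> \<bar>V L - U L - (V K - U K)\<bar> < e"
  proof (intro exI[of _ "min d1 d2"] conjI allI impI)
    fix L assume "star_body L" "radial_dist K L < min d1 d2"
    then show "\<bar>V L - U L - (V K - U K)\<bar> < e"
      using d1(2)[of L] d2(2)[of L] by linarith
  qed (use d1 d2 in simp)
qed

text \<open>The radial distance of two concentric balls is at most the difference of their radii, so
  radial continuity of \<open>V\<close> becomes ordinary continuity in the radius.\<close>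

lemma continuous_on_valuation_cball:
  fixes V :: "(real ^ 'n) set \<Rightarrow> real"
  assumes V: "radial_continuous V"
  shows "continuous_on {0..} (\<lambda>c. V (cball 0 c))"
  unfolding continuous_on_iff
proof (intro ballI allI impI)
  fix c e :: real assume c: "c \<in> {0..}" and e: "0 < e"
  then obtain d where d: "d > 0"
      "\<And>L. star_body L \<Longrightarrow> radial_dist (cball 0 c) L < d \<Longrightarrow> \<bar>V L - V (cball 0 c)\<bar> < e"
    using V star_body_cball[of c, where 'n = 'n] unfolding radial_continuous_def by (metis atLeast_iff)
  show "\<exists>d>0. \<forall>c'\<in>{0..}. dist c' c < d \<longrightarrow> dist (V (cball 0 c')) (V (cball 0 c)) < e"
  proof (intro exI conjI ballI impI)
    fix c' assume c': "c' \<in> {0..}" "dist c' c < d"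
    have "radial_dist (cball 0 c :: (real ^ 'n) set) (cball 0 c') \<le> dist c' c"
      by (rule radial_dist_le) (use c c' in \<open>simp add: radial_function_cball dist_real_def\<close>)
    then show "dist (V (cball 0 c')) (V (cball 0 c)) < e"
      using d(2)[of "cball 0 c'"] c' star_body_cball[of c', where 'n = 'n] by (simp add: dist_real_def)
  qed (rule d)
qed

theorem corollary4p1:
  shows "(2 \<le> CARD('n) \<longrightarrow>
          (\<forall>V :: (real ^ 'n) set \<Rightarrow> real.
            rotation_invariant V \<and> radial_continuous V \<and> valuation V \<longrightarrow>
            (\<exists>\<theta> :: real \<Rightarrow> real. continuous_on {0..} \<theta> \<and>
              (\<forall>K. star_body K \<longrightarrow>
                V K = (\<integral>t. \<theta> (radial_function K t) \<partial>sphere_measure))))) \<and>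
        (\<forall>\<theta> :: real \<Rightarrow> real. continuous_on {0..} \<theta> \<longrightarrow>
          (\<forall>V :: (real ^ 'n) set \<Rightarrow> real.
            (\<forall>K. star_body K \<longrightarrow>
              V K = (\<integral>t. \<theta> (radial_function K t) \<partial>sphere_measure)) \<longrightarrow>
            radial_continuous V \<and> rotation_invariant V \<and> valuation V))"
proof (intro conjI impI allI)
  fix V :: "(real ^ 'n) set \<Rightarrow> real"
  assume n: "2 \<le> CARD('n)" and V: "rotation_invariant V \<and> radial_continuous V \<and> valuation V"
  \<comment> \<open>As the sphere has total measure 1, evaluating the desired formula at the ball of
    radius \<open>c \<ge> 0\<close> forces this choice.\<close>
  define \<theta> where "\<theta> c = V (cball 0 c)" for c
  define U where "U K = (\<integral>t. \<theta> (radial_function K t) \<partial>sphere_measure)" for K :: "(real ^ 'n) set"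
  have \<theta>: "continuous_on {0..} \<theta>"
    using V continuous_on_valuation_cball unfolding \<theta>_def by blast
  note U = rotation_invariant_integral[OF \<theta> U_def] radial_continuous_integral[OF \<theta> U_def]
    valuation_integral[OF \<theta> U_def]
  have ball: "U (cball 0 c) = V (cball 0 c)" if "0 \<le> c" for c
  proof -
    have "U (cball 0 c) = (\<integral>t. \<theta> c \<partial>(sphere_measure :: (real ^ 'n) measure))"
      unfolding U_def by (rule Bochner_Integration.integral_cong[OF refl])
        (simp add: radial_function_cball[OF that] space_sphere_measure)
    then show ?thesis
      by (simp add: \<theta>_def measure_def space_sphere_measure emeasure_sphere_measure_sphere)
  qed
  \<comment> \<open>The two differences \<open>V - U\<close> and \<open>U - V\<close> both vanish on
    balls, so each is at most 0 on every star body.\<close>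
  have "V K = U K" if "star_body K" for K
  proof (rule antisym)
    show "V K \<le> U K"
      using rotation_invariant_valuation_le_0[OF n, of "\<lambda>L. V L - U L" K] that V U ball
      by (simp add: rotation_invariant_valuation_diff radial_continuous_diff valuation_diff)
    show "U K \<le> V K"
      using rotation_invariant_valuation_le_0[OF n, of "\<lambda>L. U L - V L" K] that V U ball
      by (simp add: rotation_invariant_valuation_diff radial_continuous_diff valuation_diff)
  qed
  then show "\<exists>\<theta>. continuous_on {0..} \<theta> \<and>
      (\<forall>K. star_body K \<longrightarrow> V K = (\<integral>t. \<theta> (radial_function K t) \<partial>sphere_measure))"
    using \<theta> unfolding U_def by blast
next
  fix \<theta> :: "real \<Rightarrow> real" and V :: "(real ^ 'n) set \<Rightarrow> real"
  assume \<theta>: "continuous_on {0..} \<theta>"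
    and V: "\<forall>K. star_body K \<longrightarrow> V K = (\<integral>t. \<theta> (radial_function K t) \<partial>sphere_measure)"
  then show "radial_continuous V" "rotation_invariant V" "valuation V"
    using radial_continuous_integral[of \<theta> V] rotation_invariant_integral[of \<theta> V] valuation_integral[of \<theta> V]
    by blast+
qed

end
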